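(* Let $(\tilde{\mathbf R}^*(\mathbf J),\mathbf W^*(\mathbf J))_{\mathbf J\in\mathcal J}$ be an optimal solution of problem (P) described in the context, let $\boldsymbol\lambda^{R*}$ be the vector of optimal Lagrange multipliers of the average rate constraints, and let $\mathcal M(\mathbf J,k)$ be the set of winner users defined in the context. Then for every $\mathbf J\in\mathcal J$ and every channel $k$, the optimum scheduling $\mathbf W^*(\mathbf J)$ satisfies: (i) if $[\mathbf W^*(\mathbf J)]_{m,k}>0$, then $m\in\mathcal M(\mathbf J,k)$; (ii) if $|\mathcal M(\mathbf J,k)|>0$, then $\sum_{m\in\mathcal M(\mathbf J,k)}[\mathbf W^*(\mathbf J)]_{m,k}=1$; (iii) if $|\mathcal M(\mathbf J,k)|=0$, then $[\mathbf W^*(\mathbf J)]_{m,k}=0$ for all $m$.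
   Context: There are $M$ users ($m=1,\dots,M$) and $K$ orthogonal channels ($k=1,\dots,K$). The quantized channel state is a random $M\times K$ matrix $\mathbf J$ taking values in a finite set $\mathcal J$ with probability mass function $\Pr\{\mathbf J\}>0$; the entry $[\mathbf J]_{m,k}$ is the index of the quantization region $\mathcal R([\mathbf J]_{m,k})$ in which the gain of user $m$ on channel $k$ falls. For each region there is a power-rate function $\Upsilon_{\mathcal R([\mathbf J]_{m,k})}$ of the rate $x\ge 0$. Standing assumption: each $\Upsilon_{\mathcal R([\mathbf J]_{m,k})}$ is increasing and strictly convex; it is differentiable, $\dot\Upsilon$ denotes its derivative and $\dot\Upsilon^{-1}$ the inverse function of $\dot\Upsilon$. The vector $\boldsymbol\mu\in\mathbb R^M$ collects user weights ($[\boldsymbol\mu]_m>0$) and $\check{\mathbf r}\in\mathbb R^M$ collects minimum average rate requirements. Problem (P): over matrices $\tilde{\mathbf R}(\mathbf J)\ge 0$, $\mathbf W(\mathbf J)\ge 0$ (of size $M\times K$, entrywise nonnegative, one pair for each $\mathbf J\in\mathcal J$), $$\min\ \sum_{\mathbf J\in\mathcal J}\left(\sum_{m=1}^M[\boldsymbol\mu]_m\sum_{k=1}^K\Upsilon_{\mathcal R([\mathbf J]_{m,k})}\left(\frac{[\tilde{\mathbf R}(\mathbf J)]_{m,k}}{[\mathbf W(\mathbf J)]_{m,k}}\right)[\mathbf W(\mathbf J)]_{m,k}\right)\Pr\{\mathbf J\}$$ subject to $$\sum_{\mathbf J\in\mathcal J}\left(\sum_{k=1}^K[\tilde{\mathbf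 R}(\mathbf J)]_{m,k}\right)\Pr\{\mathbf J\}\ge[\check{\mathbf r}]_m\ \ \forall m,\qquad \sum_{m=1}^M[\mathbf W(\mathbf J)]_{m,k}\le 1\ \ \forall k,\ \forall\mathbf J .$$ Here $[\tilde{\mathbf R}(\mathbf J)]_{m,k}:=[\mathbf R(\mathbf J)]_{m,k}[\mathbf W(\mathbf J)]_{m,k}$ where $[\mathbf R(\mathbf J)]_{m,k}\ge0$ is the nominal rate; in particular $[\mathbf W(\mathbf J)]_{m,k}=0$ forces $[\tilde{\mathbf R}(\mathbf J)]_{m,k}=0$ and the corresponding cost term is $0$. Problem (P) is convex and assumed strictly feasible, so that the KKT conditions are necessary and sufficient for optimality. $[\boldsymbol\lambda^{R*}]_m\ge 0$ is the optimal KKT multiplier of the $m$th average rate constraint. Optimal nominal rate: $[\mathbf R^*(\mathbf J)]_{m,k}:=\dot\Upsilon^{-1}_{\mathcal R([\mathbf J]_{m,k})}\big([\boldsymbol\lambda^{R*}]_m/[\boldsymbol\mu]_m\big)$, with $[\mathbf R^*(\mathbf J)]_{m,k}:=0$ when $[\boldsymbol\lambda^{R*}]_m/[\boldsymbol\mu]_m<\dot\Upsilon_{\mathcal R([\mathbf J]_{m,k})}(0)$. Scheduling cost: $[\mathbf C_W(\mathbf J)]_{m,k}:=[\boldsymbol\mu]_m\Upsilon_{\mathcal R([\mathbf J]_{m,k})}([\mathbf R^*(\mathbf J)]_{m,k})-[\boldsymbol\lambda^{R*}]_m[\mathbf R^*(\mathbf J)]_{m,k}$. Minimum cost: $[\mathbf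 c_W^*(\mathbf J)]_k:=\min_{1\le m\le M}[\mathbf C_W(\mathbf J)]_{m,k}$. Winner set: $\mathcal M(\mathbf J,k):=\{m:\ [\mathbf C_W(\mathbf J)]_{m,k}=[\mathbf c_W^*(\mathbf J)]_k\ \text{and}\ [\mathbf c_W^*(\mathbf J)]_k<0\}$.
   Formalization: The formal theorem additionally assumes that every power-rate function vanishes at rate zero, and that the optimal solution has positive scheduling W only where the rate R̃ is positive; without either assumption the statement is false. *)

theory Defs
  imports "HOL-Probability.Probability"
begin

text \<open>
  Users and channels are the finite index types \<open>'m\<close> and \<open>'k\<close>.  The channel state is distributed
  according to a pmf \<open>p\<close> over matrices of region indices; its support \<open>set_pmf p\<close> is the (finite) set
  of channel states of positive probability.  \<open>Y q\<close> is the power-rate function of region \<open>q\<close>; only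
  its values on \<open>{0..}\<close> matter.
\<close>

type_synonym ('q, 'k, 'm) csi = "'q ^ 'k ^ 'm"
type_synonym ('q, 'k, 'm) alloc = "('q, 'k, 'm) csi \<Rightarrow> real ^ 'k ^ 'm"

definition strictly_convex_on :: "real set \<Rightarrow> (real \<Rightarrow> real) \<Rightarrow> bool" where
  "strictly_convex_on S f \<longleftrightarrow> convex S \<and>
     (\<forall>x\<in>S. \<forall>y\<in>S. \<forall>t. x \<noteq> y \<longrightarrow> 0 < t \<longrightarrow> t < 1 \<longrightarrow>
        f ((1 - t) * x + t * y) < (1 - t) * f x + t * f y)"

text \<open>The condition \<open>f 0 = 0\<close> says that transmitting at rate zero requires no power.\<close>

definition power_rate_function :: "(real \<Rightarrow> real) \<Rightarrow> bool" where
  "power_rate_function f \<longleftrightarrow>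
     f 0 = 0 \<and> strict_mono_on {0..} f \<and> strictly_convex_on {0..} f \<and> f differentiable_on {0..}"

text \<open>The derivative on the half-line; it is one-sided at zero.\<close>

definition rate_deriv :: "(real \<Rightarrow> real) \<Rightarrow> real \<Rightarrow> real" where
  "rate_deriv f x = vector_derivative f (at x within {0..})"

text \<open>The inverse function of the derivative, with junk value 0 outside the range of the derivative.\<close>

definition rate_deriv_inv :: "(real \<Rightarrow> real) \<Rightarrow> real \<Rightarrow> real" where
  "rate_deriv_inv f y =
     (if y \<in> rate_deriv f ` {0..} then inv_into {0..} (rate_deriv f) y else 0)"

text \<open>
  In the cost, a pair with \<open>W J $ m $ k = 0\<close> contributes 0, since \<open>x / 0 = 0\<close> and the quotient is
  multiplied by \<open>W J $ m $ k\<close>.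
\<close>

definition avg_power ::
  "('q, 'k::finite, 'm::finite) csi pmf \<Rightarrow> real ^ 'm \<Rightarrow> ('q \<Rightarrow> real \<Rightarrow> real) \<Rightarrow>
   ('q, 'k, 'm) alloc \<Rightarrow> ('q, 'k, 'm) alloc \<Rightarrow> real" where
  "avg_power p \<mu> Y R W =
     (\<Sum>J\<in>set_pmf p.
        (\<Sum>m\<in>UNIV. \<mu> $ m * (\<Sum>k\<in>UNIV. Y (J $ m $ k) (R J $ m $ k / W J $ m $ k) * W J $ m $ k))
        * pmf p J)"

definition avg_rate ::
  "('q, 'k::finite, 'm::finite) csi pmf \<Rightarrow> ('q, 'k, 'm) alloc \<Rightarrow> 'm \<Rightarrow> real" where
  "avg_rate p R m = (\<Sum>J\<in>set_pmf p. (\<Sum>k\<in>UNIV. R J $ m $ k) * pmf p J)"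

text \<open>
  The domain of the problem: since \<open>R J $ m $ k\<close> stands for the product of the nominal rate with
  \<open>W J $ m $ k\<close>, it has to vanish whenever \<open>W J $ m $ k\<close> does.
\<close>

definition admissible ::
  "('q, 'k::finite, 'm::finite) csi pmf \<Rightarrow> ('q, 'k, 'm) alloc \<Rightarrow> ('q, 'k, 'm) alloc \<Rightarrow> bool" where
  "admissible p R W \<longleftrightarrow>
     (\<forall>J\<in>set_pmf p. \<forall>m k. 0 \<le> R J $ m $ k \<and> 0 \<le> W J $ m $ k \<and>
        (W J $ m $ k = 0 \<longrightarrow> R J $ m $ k = 0))"

definition feasible ::
  "('q, 'k::finite, 'm::finite) csi pmf \<Rightarrow> real ^ 'm \<Rightarrow>
   ('q, 'k, 'm) alloc \<Rightarrow> ('q, 'k, 'm) alloc \<Rightarrow> bool" where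
  "feasible p r R W \<longleftrightarrow> admissible p R W \<and>
     (\<forall>m. avg_rate p R m \<ge> r $ m) \<and>
     (\<forall>J\<in>set_pmf p. \<forall>k. (\<Sum>m\<in>UNIV. W J $ m $ k) \<le> 1)"

definition strictly_feasible ::
  "('q, 'k::finite, 'm::finite) csi pmf \<Rightarrow> real ^ 'm \<Rightarrow> bool" where
  "strictly_feasible p r \<longleftrightarrow> (\<exists>R W. admissible p R W \<and>
     (\<forall>m. avg_rate p R m > r $ m) \<and>
     (\<forall>J\<in>set_pmf p. \<forall>k. (\<Sum>m\<in>UNIV. W J $ m $ k) < 1))"

definition optimal_solution ::
  "('q, 'k::finite, 'm::finite) csi pmf \<Rightarrow> real ^ 'm \<Rightarrow> ('q \<Rightarrow> real \<Rightarrow> real) \<Rightarrow> real ^ 'm \<Rightarrow>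
   ('q, 'k, 'm) alloc \<Rightarrow> ('q, 'k, 'm) alloc \<Rightarrow> bool" where
  "optimal_solution p \<mu> Y r R W \<longleftrightarrow> feasible p r R W \<and>
     (\<forall>R' W'. feasible p r R' W' \<longrightarrow> avg_power p \<mu> Y R W \<le> avg_power p \<mu> Y R' W')"

definition lagrangian ::
  "('q, 'k::finite, 'm::finite) csi pmf \<Rightarrow> real ^ 'm \<Rightarrow> ('q \<Rightarrow> real \<Rightarrow> real) \<Rightarrow> real ^ 'm \<Rightarrow>
   real ^ 'm \<Rightarrow> (('q, 'k, 'm) csi \<Rightarrow> real ^ 'k) \<Rightarrow>
   ('q, 'k, 'm) alloc \<Rightarrow> ('q, 'k, 'm) alloc \<Rightarrow> real" where
  "lagrangian p \<mu> Y r lamR lamW R W =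
     avg_power p \<mu> Y R W
     + (\<Sum>m\<in>UNIV. lamR $ m * (r $ m - avg_rate p R m))
     + (\<Sum>J\<in>set_pmf p. \<Sum>k\<in>UNIV. lamW J $ k * ((\<Sum>m\<in>UNIV. W J $ m $ k) - 1))"

text \<open>
  The KKT conditions of the convex problem.  The cost is not differentiable where some entry of \<open>W\<close>
  vanishes, so stationarity is the subdifferential condition that 0 is a subgradient, at \<open>(R, W)\<close>,
  of the Lagrangian restricted to its domain; unfolded, \<open>(R, W)\<close> minimises the Lagrangian there.
\<close>

definition kkt_conditions ::
  "('q, 'k::finite, 'm::finite) csi pmf \<Rightarrow> real ^ 'm \<Rightarrow> ('q \<Rightarrow> real \<Rightarrow> real) \<Rightarrow> real ^ 'm \<Rightarrow>
   real ^ 'm \<Rightarrow> (('q, 'k, 'm) csi \<Rightarrow> real ^ 'k) \<Rightarrow>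
   ('q, 'k, 'm) alloc \<Rightarrow> ('q, 'k, 'm) alloc \<Rightarrow> bool" where
  "kkt_conditions p \<mu> Y r lamR lamW R W \<longleftrightarrow>
     feasible p r R W \<and>
     (\<forall>m. 0 \<le> lamR $ m) \<and> (\<forall>J\<in>set_pmf p. \<forall>k. 0 \<le> lamW J $ k) \<and>
     (\<forall>m. lamR $ m * (r $ m - avg_rate p R m) = 0) \<and>
     (\<forall>J\<in>set_pmf p. \<forall>k. lamW J $ k * ((\<Sum>m\<in>UNIV. W J $ m $ k) - 1) = 0) \<and>
     (\<forall>R' W'. admissible p R' W' \<longrightarrow>
        lagrangian p \<mu> Y r lamR lamW R W \<le> lagrangian p \<mu> Y r lamR lamW R' W')"

definition optimal_rate_multipliers ::
  "('q, 'k::finite, 'm::finite) csi pmf \<Rightarrow> real ^ 'm \<Rightarrow> ('q \<Rightarrow> real \<Rightarrow> real) \<Rightarrow> real ^ 'm \<Rightarrow>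
   real ^ 'm \<Rightarrow> bool" where
  "optimal_rate_multipliers p \<mu> Y r lamR \<longleftrightarrow>
     (\<exists>lamW R W. kkt_conditions p \<mu> Y r lamR lamW R W)"

definition nominal_rate ::
  "real ^ 'm \<Rightarrow> ('q \<Rightarrow> real \<Rightarrow> real) \<Rightarrow> real ^ 'm \<Rightarrow>
   ('q, 'k::finite, 'm::finite) csi \<Rightarrow> 'm \<Rightarrow> 'k \<Rightarrow> real" where
  "nominal_rate \<mu> Y lamR J m k =
     (if lamR $ m / \<mu> $ m < rate_deriv (Y (J $ m $ k)) 0 then 0
      else rate_deriv_inv (Y (J $ m $ k)) (lamR $ m / \<mu> $ m))"

definition sched_cost ::
  "real ^ 'm \<Rightarrow> ('q \<Rightarrow> real \<Rightarrow> real) \<Rightarrow> real ^ 'm \<Rightarrow>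
   ('q, 'k::finite, 'm::finite) csi \<Rightarrow> 'm \<Rightarrow> 'k \<Rightarrow> real" where
  "sched_cost \<mu> Y lamR J m k =
     \<mu> $ m * Y (J $ m $ k) (nominal_rate \<mu> Y lamR J m k) - lamR $ m * nominal_rate \<mu> Y lamR J m k"

definition min_sched_cost ::
  "real ^ 'm \<Rightarrow> ('q \<Rightarrow> real \<Rightarrow> real) \<Rightarrow> real ^ 'm \<Rightarrow>
   ('q, 'k::finite, 'm::finite) csi \<Rightarrow> 'k \<Rightarrow> real" where
  "min_sched_cost \<mu> Y lamR J k = Min (range (\<lambda>m. sched_cost \<mu> Y lamR J m k))"

definition winners ::
  "real ^ 'm \<Rightarrow> ('q \<Rightarrow> real \<Rightarrow> real) \<Rightarrow> real ^ 'm \<Rightarrow>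
   ('q, 'k::finite, 'm::finite) csi \<Rightarrow> 'k \<Rightarrow> 'm set" where
  "winners \<mu> Y lamR J k =
     {m. sched_cost \<mu> Y lamR J m k = min_sched_cost \<mu> Y lamR J k \<and> min_sched_cost \<mu> Y lamR J k < 0}"

text \<open>
  Time on a channel is scheduled only to a user who actually transmits there.  At zero rate
  a scheduled fraction costs nothing, so optimality alone leaves it undetermined.
\<close>

definition no_idle_scheduling ::
  "('q, 'k::finite, 'm::finite) csi pmf \<Rightarrow> ('q, 'k, 'm) alloc \<Rightarrow> ('q, 'k, 'm) alloc \<Rightarrow> bool" where
  "no_idle_scheduling p R W \<longleftrightarrow>
     (\<forall>J\<in>set_pmf p. \<forall>m k. W J $ m $ k > 0 \<longrightarrow> R J $ m $ k > 0)"

end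

theory Submission
  imports Defs
begin

text \<open>
  KKT multipliers are shared by all optimal solutions, so the given optimal solution minimises the
  Lagrangian.  The Lagrangian is a sum of terms, one for each state, user and channel, and each of
  them is positively homogeneous in the pair of rate and scheduled fraction, so its minimal value
  is 0.  Hence with \<open>\<nu>\<close> the multiplier of the channel constraint, \<open>\<mu> Y x - \<lambda> x \<ge> - \<nu> / Pr J\<close>
  for all users and all \<open>x \<ge> 0\<close>, with equality at the nominal rate of every scheduled user.
  A scheduled user therefore attains the minimal cost, which is negative by strict convexity; and
  a negative minimal cost forces \<open>\<nu> > 0\<close>, so that complementary slackness fills the channel.
\<close>

section \<open>Strict convexity, derivatives and the nominal rate\<close>

lemma has_rate_deriv:
  assumes "f differentiable_on {0..}" and "0 \<le> x"
  shows "(f has_real_derivative rate_deriv f x) (at x within {0..})"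
proof -
  have "f differentiable (at x within {0..})"
    using assms by (simp add: differentiable_on_def)
  then show ?thesis
    unfolding rate_deriv_def has_real_derivative_iff_has_vector_derivative
    by (simp add: vector_derivative_works)
qed

lemma strictly_convex_onD:
  assumes "strictly_convex_on S f" and "x \<in> S" and "y \<in> S" and "x \<noteq> y" and "0 < t" and "t < 1"
  shows "f ((1 - t) * x + t * y) < (1 - t) * f x + t * f y"
  using assms by (simp add: strictly_convex_on_def)

text \<open>Difference quotients along the segment from \<open>u\<close> stay below the chord and
  tend to the derivative term, which gives the non-strict bound. The derivative is taken within
  \<open>S\<close>, so the one-sided derivative at rate zero is covered.\<close>

lemma tangent_below_strictly_convex:
  assumes conv: "strictly_convex_on S f"
    and deriv: "(f has_real_derivative d) (at u within S)"
    and uv: "u \<in> S" "v \<in> S" "u \<noteq> v"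
  shows "f u + d * (v - u) < f v"
proof -
  have weak: "d * (w - u) \<le> f w - f u" if w: "w \<in> S" "w \<noteq> u" for w
  proof -
    define g where "g t = (1 - t) * u + t * w" for t :: real
    have conv_S: "convex S"
      using conv by (simp add: strictly_convex_on_def)
    have g_mem: "g t \<in> S" if "t \<in> {0..1}" for t
      using convexD_alt[OF conv_S uv(1) w(1), of t] that by (simp add: g_def)
    have "(g has_real_derivative (w - u)) (at 0 within {0..1})"
      unfolding g_def by (auto intro!: derivative_eq_intros)
    moreover have "(f has_real_derivative d) (at (g 0) within g ` {0..1})"
      using deriv g_mem by (auto simp: g_def intro: DERIV_subset)
    ultimately have "(f \<circ> g has_real_derivative d * (w - u)) (at 0 within {0..1})"
      by (intro DERIV_image_chain)
    then have lim: "((\<lambda>t. (f (g t) - f u) / t) \<longlongrightarrow> d * (w - u)) (at 0 within {0..1})"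
      by (simp add: has_field_derivative_iff g_def)
    have "\<forall>\<^sub>F t in at 0 within {0..1}. (f (g t) - f u) / t \<le> f w - f u"
      unfolding eventually_at
    proof (intro exI[of _ 1] conjI ballI impI)
      fix t :: real
      assume "t \<in> {0..1}" and "t \<noteq> 0 \<and> dist t 0 < 1"
      then have t: "0 < t" "t < 1"
        by (auto simp: dist_real_def)
      then have "f (g t) < (1 - t) * f u + t * f w"
        unfolding g_def using uv(1) w by (intro strictly_convex_onD[OF conv]) auto
      with t show "(f (g t) - f u) / t \<le> f w - f u"
        by (simp add: field_simps)
    qed simp
    moreover have "at (0::real) within {0..1} \<noteq> bot"
      by (simp add: at_within_Icc_at_right)
    ultimately show ?thesis
      using lim tendsto_upperbound by blast
  qed
  \<comment> \<open>Strictness comes from the midpoint: the weak bound holds there, while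
    \<open>f\<close> lies strictly below the chord.\<close>
  define w where "w = (1 - 1/2) * u + 1/2 * v"
  have "w \<in> S"
    using convexD_alt[of S u v "1/2"] conv uv by (simp add: strictly_convex_on_def w_def)
  moreover have "w \<noteq> u"
    using uv(3) by (simp add: w_def)
  moreover have "f w < (1 - 1/2) * f u + 1/2 * f v"
    unfolding w_def using uv by (intro strictly_convex_onD[OF conv]) auto
  ultimately show ?thesis
    using weak[of w] by (simp add: w_def field_simps)
qed

text \<open>Add the strict tangent inequalities taken at \<open>u\<close> and at \<open>v\<close>;
  the function values cancel.\<close>

lemma rate_deriv_less:
  assumes f: "power_rate_function f" and "0 \<le> u" and "u < v"
  shows "rate_deriv f u < rate_deriv f v"
proof -
  have conv: "strictly_convex_on {0..} f" and diff: "f differentiable_on {0..}"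
    using f by (auto simp: power_rate_function_def)
  have "f u + rate_deriv f u * (v - u) < f v"
    using assms by (intro tangent_below_strictly_convex[OF conv] has_rate_deriv[OF diff]) auto
  moreover have "f v + rate_deriv f v * (u - v) < f u"
    using assms by (intro tangent_below_strictly_convex[OF conv] has_rate_deriv[OF diff]) auto
  ultimately have "(v - u) * rate_deriv f u < (v - u) * rate_deriv f v"
    by (simp add: algebra_simps)
  then show ?thesis
    using \<open>u < v\<close> by simp
qed

lemma inj_on_rate_deriv:
  assumes "power_rate_function f"
  shows "inj_on (rate_deriv f) {0..}"
  using rate_deriv_less[OF assms] by (intro linorder_inj_onI) fastforce+

lemma nominal_rate_nonneg: "0 \<le> nominal_rate \<mu> Y lamR J m k"
  using inv_into_into[of _ "rate_deriv (Y (J $ m $ k))" "{0..}"]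
  by (auto simp: nominal_rate_def rate_deriv_inv_def)

text \<open>A positive minimiser is interior, hence stationary: the derivative at \<open>x\<close>
  equals \<open>lamR $ m / \<mu> $ m\<close>. Strict monotonicity of the derivative then excludes
  the threshold case and makes \<open>inv_into\<close> return \<open>x\<close>.\<close>

lemma nominal_rate_eqI:
  assumes f: "power_rate_function (Y (J $ m $ k))" and "0 < \<mu> $ m" and "0 < x"
    and min: "\<And>y. 0 \<le> y \<Longrightarrow>
      \<mu> $ m * Y (J $ m $ k) x - lamR $ m * x \<le> \<mu> $ m * Y (J $ m $ k) y - lamR $ m * y"
  shows "nominal_rate \<mu> Y lamR J m k = x"
proof -
  let ?f = "Y (J $ m $ k)"
  have "(?f has_real_derivative rate_deriv ?f x) (at x within {0..})"
    using f \<open>0 < x\<close> by (intro has_rate_deriv) (auto simp: power_rate_function_def)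
  moreover have "at x within {0..} = at x"
    using \<open>0 < x\<close> by (intro at_within_interior) simp
  ultimately have "(?f has_real_derivative rate_deriv ?f x) (at x)"
    by simp
  then have "((\<lambda>y. \<mu> $ m * ?f y - lamR $ m * y) has_real_derivative
      \<mu> $ m * rate_deriv ?f x - lamR $ m) (at x)"
    by (auto intro!: derivative_eq_intros)
  \<comment> \<open>The radius \<open>d = x\<close> keeps the neighbourhood inside the positive
    half-line, where \<open>min\<close> applies.\<close>
  then have "\<mu> $ m * rate_deriv ?f x - lamR $ m = 0"
    by (rule DERIV_local_min[where d = x]) (use \<open>0 < x\<close> min in auto)
  then have eq: "lamR $ m / \<mu> $ m = rate_deriv ?f x"
    using \<open>0 < \<mu> $ m\<close> by (simp add: field_simps)
  have "rate_deriv ?f 0 < rate_deriv ?f x"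
    using rate_deriv_less[OF f] \<open>0 < x\<close> by simp
  then show ?thesis
    unfolding nominal_rate_def rate_deriv_inv_def eq
    using inv_into_f_f[OF inj_on_rate_deriv[OF f], of x] \<open>0 < x\<close> by auto
qed

text \<open>If \<open>y\<close> were a second minimiser, the midpoint would have a value strictly
  below the minimum.\<close>

lemma strictly_convex_on_minimiser_less:
  assumes "strictly_convex_on S f" and "0 < a" and "x \<in> S" and "y \<in> S" and "x \<noteq> y"
    and min: "\<And>z. z \<in> S \<Longrightarrow> a * f x - b * x \<le> a * f z - b * z"
  shows "a * f x - b * x < a * f y - b * y"
proof -
  define z where "z = (1 - 1/2) * x + 1/2 * y"
  have "z \<in> S"
    using convexD_alt[of S x y "1/2"] assms by (simp add: strictly_convex_on_def z_def)
  have "f z < (1 - 1/2) * f x + 1/2 * f y"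
    unfolding z_def using assms by (intro strictly_convex_onD[OF assms(1)]) auto
  then have "a * f z < a * ((1 - 1/2) * f x + 1/2 * f y)"
    using \<open>0 < a\<close> by simp
  with min[OF \<open>z \<in> S\<close>] show ?thesis
    by (simp add: z_def algebra_simps)
qed

section \<open>Transfer of multipliers between optimal solutions\<close>

lemma sum_nonpos_eq_0D:
  fixes f :: "'a \<Rightarrow> real"
  assumes "finite A" and "\<And>x. x \<in> A \<Longrightarrow> f x \<le> 0" and "sum f A = 0" and "a \<in> A"
  shows "f a = 0"
  using assms sum_nonneg_eq_0_iff[of A "\<lambda>x. - f x"] by (simp add: sum_negf)

text \<open>Feasibility puts the Lagrangian at \<open>(R, W)\<close> below its power, optimality
  puts that below the power at the KKT point, and this equals the minimum of the Lagrangian. The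
  chain closes, so all inequalities are equalities: \<open>(R, W)\<close> minimises the Lagrangian,
  and the nonpositive slackness terms sum to zero.\<close>

lemma kkt_conditions_optimal_solution:
  fixes R W R\<^sub>0 W\<^sub>0 :: "('q, 'k::finite, 'm::finite) alloc"
  assumes fin: "finite (set_pmf p)"
    and kkt: "kkt_conditions p \<mu> Y r lamR lamW R\<^sub>0 W\<^sub>0"
    and opt: "optimal_solution p \<mu> Y r R W"
  shows "kkt_conditions p \<mu> Y r lamR lamW R W"
proof -
  let ?A = "\<lambda>m. lamR $ m * (r $ m - avg_rate p R m)"
  let ?b = "\<lambda>J k. lamW J $ k * ((\<Sum>m\<in>UNIV. W J $ m $ k) - 1)"
  have feas: "feasible p r R W" and feas\<^sub>0: "feasible p r R\<^sub>0 W\<^sub>0"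
    and power: "avg_power p \<mu> Y R W \<le> avg_power p \<mu> Y R\<^sub>0 W\<^sub>0"
    using opt kkt by (auto simp: optimal_solution_def kkt_conditions_def)
  have A: "?A m \<le> 0" for m
    using kkt feas by (intro mult_nonneg_nonpos) (auto simp: kkt_conditions_def feasible_def)
  have b: "?b J k \<le> 0" if "J \<in> set_pmf p" for J k
    using kkt feas that by (intro mult_nonneg_nonpos) (auto simp: kkt_conditions_def feasible_def)
  have "(\<Sum>m\<in>UNIV. lamR $ m * (r $ m - avg_rate p R\<^sub>0 m)) = 0"
    by (intro sum.neutral ballI) (use kkt in \<open>simp add: kkt_conditions_def\<close>)
  moreover have "(\<Sum>J\<in>set_pmf p. \<Sum>k\<in>UNIV. lamW J $ k * ((\<Sum>m\<in>UNIV. W\<^sub>0 J $ m $ k) - 1)) = 0"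
    by (intro sum.neutral ballI) (use kkt in \<open>simp add: kkt_conditions_def\<close>)
  ultimately have lag\<^sub>0: "lagrangian p \<mu> Y r lamR lamW R\<^sub>0 W\<^sub>0 = avg_power p \<mu> Y R\<^sub>0 W\<^sub>0"
    by (simp add: lagrangian_def)
  have min\<^sub>0: "lagrangian p \<mu> Y r lamR lamW R\<^sub>0 W\<^sub>0 \<le> lagrangian p \<mu> Y r lamR lamW R' W'"
    if "admissible p R' W'" for R' W'
    using kkt that by (simp add: kkt_conditions_def)
  have "(\<Sum>m\<in>UNIV. ?A m) \<le> 0" and "(\<Sum>J\<in>set_pmf p. \<Sum>k\<in>UNIV. ?b J k) \<le> 0"
    using A b by (auto intro!: sum_nonpos)
  moreover have "lagrangian p \<mu> Y r lamR lamW R\<^sub>0 W\<^sub>0 \<le> lagrangian p \<mu> Y r lamR lamW R W"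
    using min\<^sub>0 feas by (simp add: feasible_def)
  ultimately have sum_A: "(\<Sum>m\<in>UNIV. ?A m) = 0"
    and sum_b: "(\<Sum>J\<in>set_pmf p. \<Sum>k\<in>UNIV. ?b J k) = 0"
    and lag: "lagrangian p \<mu> Y r lamR lamW R W = lagrangian p \<mu> Y r lamR lamW R\<^sub>0 W\<^sub>0"
    using power lag\<^sub>0 unfolding lagrangian_def by linarith+
  have "?A m = 0" for m
    by (rule sum_nonpos_eq_0D[OF finite A sum_A UNIV_I])
  \<comment> \<open>The double sum is peeled twice: first the state, then the channel.\<close>
  moreover have "?b J k = 0" if J: "J \<in> set_pmf p" for J k
  proof -
    have "(\<Sum>k\<in>UNIV. ?b J k) = 0"
      by (rule sum_nonpos_eq_0D[OF fin _ sum_b J]) (use b in \<open>auto intro: sum_nonpos\<close>)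
    then show ?thesis
      by (rule sum_nonpos_eq_0D[OF finite b[OF J] _ UNIV_I])
  qed
  ultimately show ?thesis
    using kkt feas min\<^sub>0 lag unfolding kkt_conditions_def by metis
qed

section \<open>Separation of the Lagrangian into cells\<close>

text \<open>The share of one state, user and channel in the Lagrangian. The power term is the
  perspective of \<open>Y (J $ m $ k)\<close>, which is the source of homogeneity.\<close>

definition cell_cost ::
  "('q, 'k::finite, 'm::finite) csi pmf \<Rightarrow> real ^ 'm \<Rightarrow> ('q \<Rightarrow> real \<Rightarrow> real) \<Rightarrow> real ^ 'm \<Rightarrow>
   (('q, 'k, 'm) csi \<Rightarrow> real ^ 'k) \<Rightarrow> ('q, 'k, 'm) csi \<Rightarrow> 'm \<Rightarrow> 'k \<Rightarrow> real \<Rightarrow> real \<Rightarrow> real" where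
  "cell_cost p \<mu> Y lamR lamW J m k x w =
     pmf p J * (\<mu> $ m * (Y (J $ m $ k) (x / w) * w) - lamR $ m * x) + lamW J $ k * w"

lemma cell_cost_scale:
  assumes "0 < c"
  shows "cell_cost p \<mu> Y lamR lamW J m k (c * x) (c * w) = c * cell_cost p \<mu> Y lamR lamW J m k x w"
  using assms by (simp add: cell_cost_def algebra_simps)

text \<open>The remainder is independent of \<open>R\<close> and \<open>W\<close>, so minimising the
  Lagrangian concerns the cells alone. Summing over triples lets a single cell be isolated.\<close>

lemma lagrangian_eq_sum_cell_cost:
  "lagrangian p \<mu> Y r lamR lamW R W =
     (\<Sum>(J, m, k)\<in>set_pmf p \<times> UNIV. cell_cost p \<mu> Y lamR lamW J m k (R J $ m $ k) (W J $ m $ k))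
     + ((\<Sum>m\<in>UNIV. lamR $ m * r $ m) - (\<Sum>J\<in>set_pmf p. \<Sum>k\<in>UNIV. lamW J $ k))"
proof -
  have rates: "(\<Sum>m\<in>UNIV. lamR $ m * avg_rate p R m) =
      (\<Sum>J\<in>set_pmf p. \<Sum>m\<in>UNIV. \<Sum>k\<in>UNIV. pmf p J * (lamR $ m * R J $ m $ k))"
    unfolding avg_rate_def sum_distrib_left sum_distrib_right
    by (subst sum.swap) (simp add: mult_ac)
  have channels: "(\<Sum>J\<in>set_pmf p. \<Sum>k\<in>UNIV. lamW J $ k * (\<Sum>m\<in>UNIV. W J $ m $ k)) =
      (\<Sum>J\<in>set_pmf p. \<Sum>m\<in>UNIV. \<Sum>k\<in>UNIV. lamW J $ k * W J $ m $ k)"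
    unfolding sum_distrib_left by (intro sum.cong refl sum.swap)
  have power: "avg_power p \<mu> Y R W = (\<Sum>J\<in>set_pmf p. \<Sum>m\<in>UNIV. \<Sum>k\<in>UNIV.
      pmf p J * (\<mu> $ m * (Y (J $ m $ k) (R J $ m $ k / W J $ m $ k) * W J $ m $ k)))"
    unfolding avg_power_def sum_distrib_left sum_distrib_right by (simp add: mult_ac)
  have "(\<Sum>(J, m, k)\<in>set_pmf p \<times> UNIV.
        cell_cost p \<mu> Y lamR lamW J m k (R J $ m $ k) (W J $ m $ k)) =
      (\<Sum>J\<in>set_pmf p. \<Sum>m\<in>UNIV. \<Sum>k\<in>UNIV.
        cell_cost p \<mu> Y lamR lamW J m k (R J $ m $ k) (W J $ m $ k))"
    unfolding UNIV_Times_UNIV[symmetric] sum.cartesian_product ..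
  also have "\<dots> = avg_power p \<mu> Y R W - (\<Sum>m\<in>UNIV. lamR $ m * avg_rate p R m)
      + (\<Sum>J\<in>set_pmf p. \<Sum>k\<in>UNIV. lamW J $ k * (\<Sum>m\<in>UNIV. W J $ m $ k))"
    unfolding rates channels power cell_cost_def
    by (simp add: sum.distrib sum_subtractf right_diff_distrib)
  finally show ?thesis
    by (simp add: lagrangian_def right_diff_distrib sum_subtractf)
qed

lemma sum_le_imp_le_single:
  fixes f g :: "'a \<Rightarrow> real"
  assumes "finite A" and "a \<in> A" and "\<And>x. x \<in> A \<Longrightarrow> x \<noteq> a \<Longrightarrow> f x = g x"
    and "sum f A \<le> sum g A"
  shows "f a \<le> g a"
  using assms sum.remove[of A a f] sum.remove[of A a g] sum.cong[of "A - {a}" "A - {a}" f g]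
  by auto

text \<open>\<open>admissible\<close> restricts each cell separately, all coupling constraints being
  priced in the Lagrangian. Hence one cell can be replaced while the others are kept.\<close>

lemma cell_cost_minimal:
  fixes R W :: "('q, 'k::finite, 'm::finite) alloc"
  assumes fin: "finite (set_pmf p)" and J: "J \<in> set_pmf p"
    and adm: "admissible p R W"
    and min: "\<And>R' W'. admissible p R' W' \<Longrightarrow>
      lagrangian p \<mu> Y r lamR lamW R W \<le> lagrangian p \<mu> Y r lamR lamW R' W'"
    and x: "0 \<le> x" "0 \<le> w" "w = 0 \<longrightarrow> x = 0"
  shows "cell_cost p \<mu> Y lamR lamW J m k (R J $ m $ k) (W J $ m $ k)
    \<le> cell_cost p \<mu> Y lamR lamW J m k x w"
proof -
  define upd where
    "upd V c = (\<lambda>I. \<chi> i j. if I = J \<and> i = m \<and> j = k then c else V I $ i $ j)"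
    for V :: "('q, 'k, 'm) alloc" and c
  let ?c = "\<lambda>R W (J, m, k). cell_cost p \<mu> Y lamR lamW J m k (R J $ m $ k) (W J $ m $ k)"
  have "admissible p (upd R x) (upd W w)"
    using adm x by (auto simp: admissible_def upd_def)
  then have "sum (?c R W) (set_pmf p \<times> UNIV) \<le> sum (?c (upd R x) (upd W w)) (set_pmf p \<times> UNIV)"
    using min by (simp add: lagrangian_eq_sum_cell_cost)
  then have "?c R W (J, m, k) \<le> ?c (upd R x) (upd W w) (J, m, k)"
    by (rule sum_le_imp_le_single[rotated 3]) (use fin J in \<open>auto simp: upd_def split: if_splits\<close>)
  then show ?thesis
    by (simp add: upd_def)
qed

text \<open>\<open>lamW J $ k\<close> acts as the price of a full unit of time on the channel: no
  rate earns more than this price, and the rate of a scheduled user earns exactly it.\<close>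

lemma kkt_conditions_price:
  fixes R W :: "('q, 'k::finite, 'm::finite) alloc"
  assumes fin: "finite (set_pmf p)" and J: "J \<in> set_pmf p"
    and kkt: "kkt_conditions p \<mu> Y r lamR lamW R W"
  shows "0 \<le> x \<Longrightarrow> - lamW J $ k \<le> pmf p J * (\<mu> $ m * Y (J $ m $ k) x - lamR $ m * x)"
    and "0 < W J $ m $ k \<Longrightarrow> x = R J $ m $ k / W J $ m $ k \<Longrightarrow>
      pmf p J * (\<mu> $ m * Y (J $ m $ k) x - lamR $ m * x) = - lamW J $ k"
proof -
  let ?c = "cell_cost p \<mu> Y lamR lamW J m k"
  let ?R = "R J $ m $ k" and ?W = "W J $ m $ k"
  have adm: "admissible p R W"
    using kkt by (simp add: kkt_conditions_def feasible_def)
  have min: "?c ?R ?W \<le> ?c x w" if "0 \<le> x" "0 \<le> w" "w = 0 \<longrightarrow> x = 0" for x w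
    using kkt that by (intro cell_cost_minimal[OF fin J adm, where r = r])
      (auto simp: kkt_conditions_def)
  \<comment> \<open>Doubling a cell doubles its cost, so a minimal cost cannot be negative;
    comparison with the empty cell shows that it cannot be positive.\<close>
  have "?c ?R ?W \<le> ?c (2 * ?R) (2 * ?W)"
    using adm J by (intro min) (auto simp: admissible_def)
  then have "0 \<le> ?c ?R ?W"
    using cell_cost_scale[of 2 p \<mu> Y lamR lamW J m k ?R ?W] by simp
  moreover have "?c ?R ?W \<le> 0"
    using min[of 0 0] by (simp add: cell_cost_def)
  ultimately have zero: "?c ?R ?W = 0"
    by simp
  show "- lamW J $ k \<le> pmf p J * (\<mu> $ m * Y (J $ m $ k) x - lamR $ m * x)" if "0 \<le> x"
    using min[of x 1] that zero by (simp add: cell_cost_def)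
  show "pmf p J * (\<mu> $ m * Y (J $ m $ k) x - lamR $ m * x) = - lamW J $ k"
    if "0 < ?W" and "x = ?R / ?W"
  proof -
    \<comment> \<open>Rescaling to a full time share carries the zero cost over to rate
      \<open>x\<close>.\<close>
    have "?c ?R ?W = ?W * ?c x 1"
      using cell_cost_scale[of ?W p \<mu> Y lamR lamW J m k x 1] that by simp
    with zero that(1) have "?c x 1 = 0"
      by simp
    then show ?thesis
      by (simp add: cell_cost_def)
  qed
qed

section \<open>Winner users and filled channels\<close>

theorem proposition2:
  fixes p :: "('q ^ 'k::finite ^ 'm::finite) pmf"
    and \<mu> r lamR :: "real ^ 'm"
    and Y :: "'q \<Rightarrow> real \<Rightarrow> real"
    and R W :: "'q ^ 'k ^ 'm \<Rightarrow> real ^ 'k ^ 'm"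
  assumes "finite (set_pmf p)"
    and "\<And>m. \<mu> $ m > 0"
    and "\<And>q. power_rate_function (Y q)"
    and "strictly_feasible p r"
    and "optimal_solution p \<mu> Y r R W"
    and "no_idle_scheduling p R W"
    and "optimal_rate_multipliers p \<mu> Y r lamR"
  shows "\<forall>J\<in>set_pmf p. \<forall>k.
      (\<forall>m. W J $ m $ k > 0 \<longrightarrow> m \<in> winners \<mu> Y lamR J k) \<and>
      (card (winners \<mu> Y lamR J k) > 0 \<longrightarrow> (\<Sum>m\<in>winners \<mu> Y lamR J k. W J $ m $ k) = 1) \<and>
      (card (winners \<mu> Y lamR J k) = 0 \<longrightarrow> (\<forall>m. W J $ m $ k = 0))"
proof (intro ballI allI)
  fix J k
  assume J: "J \<in> set_pmf p"
  obtain lamW R\<^sub>0 W\<^sub>0 where "kkt_conditions p \<mu> Y r lamR lamW R\<^sub>0 W\<^sub>0"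
    using assms(7) unfolding optimal_rate_multipliers_def by blast
  then have kkt: "kkt_conditions p \<mu> Y r lamR lamW R W"
    using assms(1,5) kkt_conditions_optimal_solution by blast
  note price = kkt_conditions_price[OF assms(1) J kkt]
  have pJ: "0 < pmf p J"
    using J by (simp add: pmf_positive)
  let ?C = "\<lambda>m. sched_cost \<mu> Y lamR J m k"
  have nonneg: "0 \<le> W J $ m $ k" for m
    using kkt J by (auto simp: kkt_conditions_def feasible_def admissible_def)
  \<comment> \<open>Nonnegativity of the nominal rate suffices, so the bound also covers the default
    rate 0 outside the range of the derivative.\<close>
  have lower: "- lamW J $ k \<le> pmf p J * ?C m" for m
    unfolding sched_cost_def by (intro price(1) nominal_rate_nonneg)
  have scheduled: "m \<in> winners \<mu> Y lamR J k" if pos: "0 < W J $ m $ k" for m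
  proof -
    let ?f = "Y (J $ m $ k)"
    define x where "x = R J $ m $ k / W J $ m $ k"
    have f: "strictly_convex_on {0..} ?f" "?f 0 = 0"
      using assms(3) by (auto simp: power_rate_function_def)
    \<comment> \<open>A positive rate makes \<open>x\<close> interior, for
      \<open>nominal_rate_eqI\<close>, and distinct from 0, for the strict comparison below.\<close>
    have "0 < x"
      using assms(6) J pos by (auto simp: no_idle_scheduling_def x_def)
    have at_x: "pmf p J * (\<mu> $ m * ?f x - lamR $ m * x) = - lamW J $ k"
      by (rule price(2)[OF pos x_def])
    have min: "\<mu> $ m * ?f x - lamR $ m * x \<le> \<mu> $ m * ?f y - lamR $ m * y" if "0 \<le> y" for y
      using price(1)[OF that, of k m, folded at_x] pJ by simp
    have "nominal_rate \<mu> Y lamR J m k = x"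
      using assms(2,3) \<open>0 < x\<close> min by (intro nominal_rate_eqI)
    then have C: "?C m = \<mu> $ m * ?f x - lamR $ m * x"
      by (simp add: sched_cost_def)
    have "?C m \<le> ?C m'" for m'
      using lower[of m', folded at_x] pJ unfolding C by simp
    then have "min_sched_cost \<mu> Y lamR J k = ?C m"
      unfolding min_sched_cost_def by (intro Min_eqI) auto
    \<comment> \<open>The competitor is rate 0, whose cost is 0 because
      \<open>?f 0 = 0\<close>.\<close>
    moreover have "?C m < 0"
      using strictly_convex_on_minimiser_less[OF f(1) assms(2), of x 0 m "lamR $ m"] \<open>0 < x\<close> min f(2)
      unfolding C by simp
    ultimately show ?thesis
      by (simp add: winners_def)
  qed
  then have idle: "W J $ m $ k = 0" if "m \<notin> winners \<mu> Y lamR J k" for m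
    using that nonneg[of m] by (auto simp: less_le)
  have "(\<Sum>m\<in>winners \<mu> Y lamR J k. W J $ m $ k) = 1"
    if nonempty: "winners \<mu> Y lamR J k \<noteq> {}"
  proof -
    obtain m where "m \<in> winners \<mu> Y lamR J k"
      using nonempty by blast
    then have "?C m < 0"
      by (simp add: winners_def)
    then have "pmf p J * ?C m < 0"
      using pJ by (simp add: mult_pos_neg)
    with lower[of m] have "lamW J $ k \<noteq> 0"
      by linarith
    then have "(\<Sum>m\<in>UNIV. W J $ m $ k) = 1"
      using kkt J by (auto simp: kkt_conditions_def)
    moreover have "(\<Sum>m\<in>winners \<mu> Y lamR J k. W J $ m $ k) = (\<Sum>m\<in>UNIV. W J $ m $ k)"
      using idle by (intro sum.mono_neutral_left) auto
    ultimately show ?thesis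
      by simp
  qed
  then show "(\<forall>m. W J $ m $ k > 0 \<longrightarrow> m \<in> winners \<mu> Y lamR J k) \<and>
      (card (winners \<mu> Y lamR J k) > 0 \<longrightarrow> (\<Sum>m\<in>winners \<mu> Y lamR J k. W J $ m $ k) = 1) \<and>
      (card (winners \<mu> Y lamR J k) = 0 \<longrightarrow> (\<forall>m. W J $ m $ k = 0))"
    using scheduled idle by (auto simp: card_gt_0_iff)
qed

end
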